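(* Let $x=\{x_{jk}\}_{j,k\in\mathbb{N}}$ be a double sequence in the normed linear space $X$ and let $r\ge 0$ be a real number. Then the rough $I$-statistical limit set $I\text{-}st\text{-}\mathrm{LIM}_x^r$ of $x$ is a closed subset of $X$.
   Context: Let $\mathbb{N}=\{1,2,3,\dots\}$ and let $(X,\|\cdot\|)$ be a normed linear space. An ideal $I$ on $\mathbb{N}\times\mathbb{N}$ is a class of subsets of $\mathbb{N}\times\mathbb{N}$ with $\emptyset\in I$, closed under finite unions and under taking subsets; it is nontrivial if $\mathbb{N}\times\mathbb{N}\notin I$. A nontrivial ideal $I$ on $\mathbb{N}\times\mathbb{N}$ is strongly admissible if $\{i\}\times\mathbb{N}\in I$ and $\mathbb{N}\times\{i\}\in I$ for every $i\in\mathbb{N}$. Throughout, $I$ is a fixed strongly admissible ideal on $\mathbb{N}\times\mathbb{N}$. For a double sequence $x=\{x_{jk}\}_{j,k\in\mathbb{N}}$ in $X$, a real number $r\ge 0$ and $\xi\in X$, $x$ is rough $I$-statistically convergent to $\xi$ with roughness degree $r$ ($\xi$ is a rough $I$-statistical limit of $x$) if for all $\varepsilon>0$ and $\delta>0$ $$\Big\{(m,n)\in\mathbb{N}\times\mathbb{N}:\ \tfrac{1}{mn}\big|\{(j,k): j\le m,\ k\le n,\ \|x_{jk}-\xi\|\ge r+\varepsilon\}\big|\ge\delta\Big\}\in I .$$ $I\text{-}st\text{-}\mathrm{LIM}_x^r$ denotes the set of all such $\xi\in X$ (it may be empty). *)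

theory Defs
  imports "HOL-Analysis.Analysis"
begin

text \<open>
  The index set of double sequences is \<open>{1,2,3,...} \<times> {1,2,3,...}\<close>. A double sequence is
  represented by a function \<open>nat \<Rightarrow> nat \<Rightarrow> 'a\<close>; its values at indices where one coordinate
  is \<open>0\<close> are junk and are never looked at below.
\<close>

abbreviation pos_nat :: "nat set" where
  "pos_nat \<equiv> {1..}"

definition ideal_on :: "'b set \<Rightarrow> 'b set set \<Rightarrow> bool" where
  "ideal_on S I \<longleftrightarrow>
     I \<subseteq> Pow S \<and> {} \<in> I \<and>
     (\<forall>A\<in>I. \<forall>B\<in>I. A \<union> B \<in> I) \<and>
     (\<forall>A\<in>I. \<forall>B. B \<subseteq> A \<longrightarrow> B \<in> I)"

definition nontrivial_ideal_on :: "'b set \<Rightarrow> 'b set set \<Rightarrow> bool" where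
  "nontrivial_ideal_on S I \<longleftrightarrow> ideal_on S I \<and> S \<notin> I"

definition strongly_admissible :: "(nat \<times> nat) set set \<Rightarrow> bool" where
  "strongly_admissible I \<longleftrightarrow>
     nontrivial_ideal_on (pos_nat \<times> pos_nat) I \<and>
     (\<forall>i\<in>pos_nat. {i} \<times> pos_nat \<in> I \<and> pos_nat \<times> {i} \<in> I)"

definition rough_I_st_convergent ::
  "(nat \<times> nat) set set \<Rightarrow> real \<Rightarrow> (nat \<Rightarrow> nat \<Rightarrow> 'a::real_normed_vector) \<Rightarrow> 'a \<Rightarrow> bool" where
  "rough_I_st_convergent I r x \<xi> \<longleftrightarrow>
     (\<forall>\<epsilon>>0. \<forall>\<delta>>0.
        {(m, n) \<in> pos_nat \<times> pos_nat.
           1 / (real m * real n) *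
             real (card {(j, k) \<in> pos_nat \<times> pos_nat.
                           j \<le> m \<and> k \<le> n \<and> norm (x j k - \<xi>) \<ge> r + \<epsilon>}) \<ge> \<delta>} \<in> I)"

definition I_st_LIM ::
  "(nat \<times> nat) set set \<Rightarrow> real \<Rightarrow> (nat \<Rightarrow> nat \<Rightarrow> 'a::real_normed_vector) \<Rightarrow> 'a set" where
  "I_st_LIM I r x = {\<xi>. rough_I_st_convergent I r x \<xi>}"

end

theory Submission
  imports Defs
begin

text \<open>
  A point \<open>\<xi>\<close> of the closure of the rough limit set has, for each \<open>\<epsilon> > 0\<close>, a rough limit
  \<open>\<eta>\<close> within distance \<open>\<epsilon> / 2\<close>. By the triangle inequality, every index at which the
  sequence is at distance at least \<open>r + \<epsilon>\<close> from \<open>\<xi>\<close> is one at which it is at distance at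
  least \<open>r + \<epsilon> / 2\<close> from \<open>\<eta>\<close>. Hence the exceptional set for \<open>\<xi>\<close> and \<open>(\<epsilon>, \<delta>)\<close> is contained
  in the one for \<open>\<eta>\<close> and \<open>(\<epsilon> / 2, \<delta>)\<close>, which lies in the ideal.
\<close>

lemma exceptional_set_mono:
  fixes x :: "nat \<Rightarrow> nat \<Rightarrow> 'a::real_normed_vector"
  assumes "norm (\<eta> - \<xi>) + s \<le> t"
  shows "{(m, n) \<in> pos_nat \<times> pos_nat.
           1 / (real m * real n) *
             real (card {(j, k) \<in> pos_nat \<times> pos_nat.
                           j \<le> m \<and> k \<le> n \<and> norm (x j k - \<xi>) \<ge> t}) \<ge> \<delta>}
       \<subseteq> {(m, n) \<in> pos_nat \<times> pos_nat.
           1 / (real m * real n) *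
             real (card {(j, k) \<in> pos_nat \<times> pos_nat.
                           j \<le> m \<and> k \<le> n \<and> norm (x j k - \<eta>) \<ge> s}) \<ge> \<delta>}"
proof -
  define C where "C = (\<lambda>\<zeta> u m n. {(j, k) \<in> pos_nat \<times> pos_nat.
                           j \<le> m \<and> k \<le> n \<and> norm (x j k - \<zeta>) \<ge> u})"
  have far: "s \<le> norm (x j k - \<eta>)" if "t \<le> norm (x j k - \<xi>)" for j k
    using that assms norm_triangle_ineq[of "x j k - \<eta>" "\<eta> - \<xi>"] by simp
  have "card (C \<xi> t m n) \<le> card (C \<eta> s m n)" for m n
  proof (rule card_mono)
    show "finite (C \<eta> s m n)"
      by (rule finite_subset[of _ "{..m} \<times> {..n}"]) (auto simp: C_def)
    show "C \<xi> t m n \<subseteq> C \<eta> s m n"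
      using far by (auto simp: C_def)
  qed
  then have "1 / (real m * real n) * real (card (C \<xi> t m n))
          \<le> 1 / (real m * real n) * real (card (C \<eta> s m n))" for m n
    by (intro mult_left_mono) auto
  then show ?thesis
    unfolding C_def by (blast intro: order_trans)
qed

theorem theorem3p5:
  fixes I :: "(nat \<times> nat) set set"
    and x :: "nat \<Rightarrow> nat \<Rightarrow> 'a::real_normed_vector"
    and r :: real
  assumes "strongly_admissible I"
    and "r \<ge> 0"
  shows "closed (I_st_LIM I r x)"
proof -
  have down: "B \<in> I" if "A \<in> I" "B \<subseteq> A" for A B
    using assms(1) that
    unfolding strongly_admissible_def nontrivial_ideal_on_def ideal_on_def by blast
  have "\<xi> \<in> I_st_LIM I r x" if cl: "\<xi> \<in> closure (I_st_LIM I r x)" for \<xi>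
    unfolding I_st_LIM_def rough_I_st_convergent_def mem_Collect_eq
  proof (intro allI impI)
    fix \<epsilon> \<delta> :: real
    assume "\<epsilon> > 0" "\<delta> > 0"
    then obtain \<eta> where \<eta>: "\<eta> \<in> I_st_LIM I r x" "dist \<eta> \<xi> < \<epsilon> / 2"
      using cl by (meson closure_approachable half_gt_zero)
    have "norm (\<eta> - \<xi>) + (r + \<epsilon> / 2) \<le> r + \<epsilon>"
      using \<eta>(2) by (simp add: dist_norm)
    moreover have "{(m, n) \<in> pos_nat \<times> pos_nat.
           1 / (real m * real n) *
             real (card {(j, k) \<in> pos_nat \<times> pos_nat.
                           j \<le> m \<and> k \<le> n \<and> norm (x j k - \<eta>) \<ge> r + \<epsilon> / 2}) \<ge> \<delta>} \<in> I"
      using \<eta>(1) half_gt_zero[OF \<open>\<epsilon> > 0\<close>] \<open>\<delta> > 0\<close>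
      unfolding I_st_LIM_def rough_I_st_convergent_def mem_Collect_eq by blast
    ultimately show "{(m, n) \<in> pos_nat \<times> pos_nat.
           1 / (real m * real n) *
             real (card {(j, k) \<in> pos_nat \<times> pos_nat.
                           j \<le> m \<and> k \<le> n \<and> norm (x j k - \<xi>) \<ge> r + \<epsilon>}) \<ge> \<delta>} \<in> I"
      by (rule down[OF _ exceptional_set_mono, rotated])
  qed
  then show ?thesis
    by (meson closure_subset_eq subsetI)
qed

end
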